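(* Let $A,B,C$ be a Leonard triple on $V$ that has $q$-Racah type with Huang data $(a,b,c,d)$, and let $\overline A=W^{-1}BW-C$ with $W$ as defined in the context. (i) If $a=q^{d+1}$, then $$\overline A=(b-c)(b-c^{-1})b^{-1}[d+1]_q\sum_{i=0}^d\frac{(A-\theta_0I)(A-\theta_1I)\cdots(A-\theta_{i-1}I)}{(\theta_0-\theta_1)(\theta_0-\theta_2)\cdots(\theta_0-\theta_i)}.$$ (ii) If $a=q^{-d-1}$, then $$\overline A=(b-c)(b-c^{-1})b^{-1}[d+1]_q\,\frac{(A-\theta_0I)(A-\theta_1I)\cdots(A-\theta_{d-1}I)}{(\theta_d-\theta_0)(\theta_d-\theta_1)\cdots(\theta_d-\theta_{d-1})}.$$ (iii) If $a\ne q^{d+1}$ and $a\ne q^{-d-1}$, then $$\overline A=\frac{(a-q^{-d-1})(b-c)(b-c^{-1})b^{-1}q^d}{a-q^{d-1}}\sum_{i=0}^d\frac{(A-\theta_0I)(A-\theta_1I)\cdots(A-\theta_{i-1}I)}{(q+q^{-1}-\theta_1)(q+q^{-1}-\theta_2)\cdots(q+q^{-1}-\theta_i)}.$$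
   Context: Let $\mathbb F$ be a field, $d\ge 0$ an integer, $V$ a vector space over $\mathbb F$ of dimension $d+1$, $\mathrm{End}(V)$ the $\mathbb F$-algebra of $\mathbb F$-linear maps $V\to V$, and $I$ its identity. A square matrix is tridiagonal if each nonzero entry lies on the diagonal, subdiagonal or superdiagonal; a tridiagonal matrix is irreducible if every subdiagonal entry and every superdiagonal entry is nonzero. Leonard triple on $V$: a 3-tuple $A,B,C$ of elements of $\mathrm{End}(V)$ such that (i) there is a basis of $V$ with respect to which $A$ is represented by a diagonal matrix and $B,C$ by irreducible tridiagonal matrices; (ii) there is a basis with respect to which $B$ is diagonal and $C,A$ are irreducible tridiagonal; (iii) there is a basis with respect to which $C$ is diagonal and $A,B$ are irreducible tridiagonal. Each of $A,B,C$ is then diagonalizable with one-dimensional eigenspaces. An ordering of the eigenvalues of $A$ is standard if corresponding eigenvectors, in that order, form a basis as in (i); similarly for $B$ with (ii) and $C$ with (iii). Standing assumptions: fix a nonzero $q\in\mathbb F$ with $q^4\ne 1$ and nonzero $a,b,c\in\mathbb F$ such that $q^{2i}\ne 1$ for $1\le i\le d$; none of $a^2,b^2,c^2$ is among $q^{2d-2},q^{2d-4},\ldots,q^{2-2d}$; none of $abc,a^{-1}bc,ab^{-1}c,abc^{-1}$ is among $q^{d-1},q^{d-3},\ldots,q^{1-d}$. For $0\le i\le d$ let $\theta_i=aq^{2i-d}+a^{-1}q^{d-2i}$, $\theta'_i=bq^{2i-d}+b^{-1}q^{d-2i}$, $\theta''_i=cq^{2i-d}+c^{-1}q^{d-2i}$.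 A Leonard triple $A,B,C$ on $V$ has $q$-Racah type with Huang data $(a,b,c,d)$ if $\{\theta_i\}_{i=0}^d$, $\{\theta'_i\}_{i=0}^d$, $\{\theta''_i\}_{i=0}^d$ are standard orderings of the eigenvalues of $A$, $B$, $C$ respectively, and $$A+\frac{qBC-q^{-1}CB}{q^2-q^{-2}}=\alpha_a I,\quad B+\frac{qCA-q^{-1}AC}{q^2-q^{-2}}=\alpha_b I,\quad C+\frac{qAB-q^{-1}BA}{q^2-q^{-2}}=\alpha_c I,$$ where $\alpha_a=\frac{(a+a^{-1})(q^{d+1}+q^{-d-1})+(b+b^{-1})(c+c^{-1})}{q+q^{-1}}$, $\alpha_b=\frac{(b+b^{-1})(q^{d+1}+q^{-d-1})+(c+c^{-1})(a+a^{-1})}{q+q^{-1}}$, $\alpha_c=\frac{(c+c^{-1})(q^{d+1}+q^{-d-1})+(a+a^{-1})(b+b^{-1})}{q+q^{-1}}$. For $0\le i\le d$ let $E_i$ be the primitive idempotent of $A$ for $\theta_i$: the projection of $V$ onto the $\theta_i$-eigenspace of $A$ that is zero on the other eigenspaces. Define $W=\sum_{i=0}^d(-1)^ia^{-i}q^{i(d-i)}E_i$, which is invertible. Also $[n]_q=\frac{q^n-q^{-n}}{q-q^{-1}}$ for $n\in\mathbb Z$. Empty products equal $I$ (for maps) or $1$ (for scalars). *)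

theory Defs
  imports Complex_Main
begin

definition qr_theta :: "'f::field \<Rightarrow> nat \<Rightarrow> 'f \<Rightarrow> nat \<Rightarrow> 'f" where
  "qr_theta q d x i =
     x * q powi (2 * int i - int d) + inverse x * q powi (int d - 2 * int i)"

definition q_bracket :: "'f::field \<Rightarrow> int \<Rightarrow> 'f" where
  "q_bracket q n = (q powi n - q powi (- n)) / (q - inverse q)"

text \<open>The exponents 2d-2, 2d-4, ..., 2-2d are the numbers 2k with -d < k < d, and the exponents
  d-1, d-3, ..., 1-d are the numbers d-1-2j with 0 <= j < d; both lists are empty for d = 0.\<close>

definition huang_params :: "'f::field \<Rightarrow> 'f \<Rightarrow> 'f \<Rightarrow> 'f \<Rightarrow> nat \<Rightarrow> bool" where
  "huang_params q a b c d \<longleftrightarrow>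
     q \<noteq> 0 \<and> q ^ 4 \<noteq> 1 \<and> a \<noteq> 0 \<and> b \<noteq> 0 \<and> c \<noteq> 0 \<and>
     (\<forall>i\<in>{1..d}. q ^ (2 * i) \<noteq> 1) \<and>
     (\<forall>x\<in>{a, b, c}. \<forall>k::int. - int d < k \<and> k < int d \<longrightarrow> x ^ 2 \<noteq> q powi (2 * k)) \<and>
     (\<forall>x\<in>{a * b * c, inverse a * b * c, a * inverse b * c, a * b * inverse c}.
        \<forall>j<d. x \<noteq> q powi (int d - 1 - 2 * int j))"

definition qr_alpha :: "'f::field \<Rightarrow> nat \<Rightarrow> 'f \<Rightarrow> 'f \<Rightarrow> 'f \<Rightarrow> 'f" where
  "qr_alpha q d x y z =
     ((x + inverse x) * (q powi (int d + 1) + q powi (- int d - 1))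
       + (y + inverse y) * (z + inverse z)) / (q + inverse q)"

text \<open>Square matrices of size d+1 are functions of two indices, of which only the values at
  indices at most d matter.\<close>

definition diagonal_matrix :: "nat \<Rightarrow> (nat \<Rightarrow> nat \<Rightarrow> 'f::zero) \<Rightarrow> bool" where
  "diagonal_matrix d M \<longleftrightarrow> (\<forall>i\<le>d. \<forall>j\<le>d. M i j \<noteq> 0 \<longrightarrow> i = j)"

definition tridiagonal_matrix :: "nat \<Rightarrow> (nat \<Rightarrow> nat \<Rightarrow> 'f::zero) \<Rightarrow> bool" where
  "tridiagonal_matrix d M \<longleftrightarrow>
     (\<forall>i\<le>d. \<forall>j\<le>d. M i j \<noteq> 0 \<longrightarrow> i = j \<or> i = Suc j \<or> j = Suc i)"

definition irreducible_tridiagonal_matrix :: "nat \<Rightarrow> (nat \<Rightarrow> nat \<Rightarrow> 'f::zero) \<Rightarrow> bool" where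
  "irreducible_tridiagonal_matrix d M \<longleftrightarrow>
     tridiagonal_matrix d M \<and> (\<forall>i<d. M (Suc i) i \<noteq> 0 \<and> M i (Suc i) \<noteq> 0)"

text \<open>A renaming of vector_space without further assumptions: definitions made in vector_space itself
  would be copied to its global interpretation real_vector, whose unqualified names shadow them.\<close>

locale vs = vector_space scale
  for scale :: "'a::field \<Rightarrow> 'b::ab_group_add \<Rightarrow> 'b" (infixr "*s" 75)
begin

definition ordered_basis :: "nat \<Rightarrow> (nat \<Rightarrow> 'b) \<Rightarrow> bool" where
  "ordered_basis d v \<longleftrightarrow>
     inj_on v {..d} \<and> independent (v ` {..d}) \<and> span (v ` {..d}) = UNIV"

definition represents :: "nat \<Rightarrow> (nat \<Rightarrow> 'b) \<Rightarrow> ('b \<Rightarrow> 'b) \<Rightarrow> (nat \<Rightarrow> nat \<Rightarrow> 'a) \<Rightarrow> bool" where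
  "represents d v X M \<longleftrightarrow> (\<forall>j\<le>d. X (v j) = (\<Sum>i\<le>d. M i j *s v i))"

definition leonard_basis ::
    "nat \<Rightarrow> ('b \<Rightarrow> 'b) \<Rightarrow> ('b \<Rightarrow> 'b) \<Rightarrow> ('b \<Rightarrow> 'b) \<Rightarrow> (nat \<Rightarrow> 'b) \<Rightarrow> bool" where
  "leonard_basis d X Y Z v \<longleftrightarrow>
     ordered_basis d v \<and>
     (\<exists>M. represents d v X M \<and> diagonal_matrix d M) \<and>
     (\<exists>M. represents d v Y M \<and> irreducible_tridiagonal_matrix d M) \<and>
     (\<exists>M. represents d v Z M \<and> irreducible_tridiagonal_matrix d M)"

definition leonard_triple :: "nat \<Rightarrow> ('b \<Rightarrow> 'b) \<Rightarrow> ('b \<Rightarrow> 'b) \<Rightarrow> ('b \<Rightarrow> 'b) \<Rightarrow> bool" where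
  "leonard_triple d A B C \<longleftrightarrow>
     Vector_Spaces.linear scale scale A \<and>
     Vector_Spaces.linear scale scale B \<and>
     Vector_Spaces.linear scale scale C \<and>
     (\<exists>v. leonard_basis d A B C v) \<and>
     (\<exists>v. leonard_basis d B C A v) \<and>
     (\<exists>v. leonard_basis d C A B v)"

definition eigenspace :: "('b \<Rightarrow> 'b) \<Rightarrow> 'a \<Rightarrow> 'b set" where
  "eigenspace X t = {v. X v = t *s v}"

definition eigenvalues :: "('b \<Rightarrow> 'b) \<Rightarrow> 'a set" where
  "eigenvalues X = {t. \<exists>v. v \<noteq> 0 \<and> v \<in> eigenspace X t}"

text \<open>The eigenspaces of a member of a Leonard triple are one-dimensional and the condition on v is
  invariant under nonzero rescaling of each v i, so the choice of eigenvectors is immaterial.\<close>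

definition standard_ordering ::
    "nat \<Rightarrow> ('b \<Rightarrow> 'b) \<Rightarrow> ('b \<Rightarrow> 'b) \<Rightarrow> ('b \<Rightarrow> 'b) \<Rightarrow> (nat \<Rightarrow> 'a) \<Rightarrow> bool" where
  "standard_ordering d X Y Z t \<longleftrightarrow>
     bij_betw t {..d} (eigenvalues X) \<and>
     (\<exists>v. (\<forall>i\<le>d. v i \<noteq> 0 \<and> v i \<in> eigenspace X (t i)) \<and> leonard_basis d X Y Z v)"

definition Z3_relation ::
    "'a \<Rightarrow> ('b \<Rightarrow> 'b) \<Rightarrow> ('b \<Rightarrow> 'b) \<Rightarrow> ('b \<Rightarrow> 'b) \<Rightarrow> 'a \<Rightarrow> bool" where
  "Z3_relation q X Y Z s \<longleftrightarrow>
     (\<forall>v. X v + inverse (q ^ 2 - inverse q ^ 2) *s (q *s Y (Z v) - inverse q *s Z (Y v)) = s *s v)"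

definition q_Racah_triple ::
    "'a \<Rightarrow> 'a \<Rightarrow> 'a \<Rightarrow> 'a \<Rightarrow> nat \<Rightarrow> ('b \<Rightarrow> 'b) \<Rightarrow> ('b \<Rightarrow> 'b) \<Rightarrow> ('b \<Rightarrow> 'b) \<Rightarrow> bool" where
  "q_Racah_triple q a b c d A B C \<longleftrightarrow>
     leonard_triple d A B C \<and>
     standard_ordering d A B C (qr_theta q d a) \<and>
     standard_ordering d B C A (qr_theta q d b) \<and>
     standard_ordering d C A B (qr_theta q d c) \<and>
     Z3_relation q A B C (qr_alpha q d a b c) \<and>
     Z3_relation q B C A (qr_alpha q d b c a) \<and>
     Z3_relation q C A B (qr_alpha q d c a b)"

text \<open>Such a projection exists, and is unique, when X is diagonalizable; elsewhere the description
  is only a totalization.\<close>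

definition primitive_idempotent :: "('b \<Rightarrow> 'b) \<Rightarrow> 'a \<Rightarrow> 'b \<Rightarrow> 'b" where
  "primitive_idempotent X t =
     (THE E. Vector_Spaces.linear scale scale E \<and>
             range E = eigenspace X t \<and>
             (\<forall>v\<in>eigenspace X t. E v = v) \<and>
             (\<forall>s. s \<noteq> t \<longrightarrow> (\<forall>v\<in>eigenspace X s. E v = 0)))"

definition W_map :: "'a \<Rightarrow> 'a \<Rightarrow> nat \<Rightarrow> ('b \<Rightarrow> 'b) \<Rightarrow> 'b \<Rightarrow> 'b" where
  "W_map q a d A v =
     (\<Sum>i\<le>d. ((- 1) ^ i * inverse a ^ i * q ^ (i * (d - i))) *s
              primitive_idempotent A (qr_theta q d a i) v)"

definition A_bar ::
    "'a \<Rightarrow> 'a \<Rightarrow> nat \<Rightarrow> ('b \<Rightarrow> 'b) \<Rightarrow> ('b \<Rightarrow> 'b) \<Rightarrow> ('b \<Rightarrow> 'b) \<Rightarrow> 'b \<Rightarrow> 'b" where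
  "A_bar q a d A B C v = inv (W_map q a d A) (B (W_map q a d A v)) - C v"

text \<open>The product (X - t 0 I)(X - t 1 I)...(X - t (i-1) I) in End(V).\<close>

primrec shifted_product :: "('b \<Rightarrow> 'b) \<Rightarrow> (nat \<Rightarrow> 'a) \<Rightarrow> nat \<Rightarrow> 'b \<Rightarrow> 'b" where
  "shifted_product X t 0 = id"
| "shifted_product X t (Suc i) = shifted_product X t i \<circ> (\<lambda>v. X v - t i *s v)"

end

end

theory Submission
  imports Defs
begin

text \<open>
  Fix an eigenbasis of \<open>A\<close> for the standard ordering \<open>\<theta>\<close>, with
  coordinate functionals \<open>f r\<close>. The map \<open>W\<close> is diagonal in it, and so is every polynomial
  in \<open>A\<close>; the point is that \<open>W\<^sup>-\<^sup>1 B W - C\<close> is diagonal as well. The relation that expresses \<open>C\<close>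
  through \<open>q A B - q\<^sup>-\<^sup>1 B A\<close> says that each off-diagonal entry of \<open>C\<close> is a scalar multiple of
  the same entry of \<open>B\<close>. Next to the diagonal, where \<open>B\<close> is supported, this scalar is exactly the
  ratio of the two entries of \<open>W\<close> that conjugation by \<open>W\<close> produces, so the off-diagonal
  entries cancel (\<open>W_weight_Suc\<close>, \<open>qr_theta_skew_Suc\<close>).

  What remains are the diagonal entries \<open>l r\<close>, the differences of the diagonal entries of \<open>B\<close>
  and \<open>C\<close>. The diagonal parts of the relations for \<open>B\<close> and for \<open>C\<close>, subtracted, give
  \<open>(q + q\<^sup>-\<^sup>1 - \<theta> r) l r = \<beta> (q^(d+1) - a) (1 - a\<^sup>-\<^sup>1 q^(-d-1))\<close> with
  \<open>\<beta> = (b - c) (b - c\<^sup>-\<^sup>1) b\<^sup>-\<^sup>1\<close>. If \<open>a\<close> is neither \<open>q^(d+1)\<close> nor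
  \<open>q^(-d-1)\<close>, then \<open>q + q\<^sup>-\<^sup>1\<close> is not an eigenvalue of \<open>A\<close> and all \<open>l r\<close> are determined. In
  the two exceptional cases the right-hand side vanishes and \<open>q + q\<^sup>-\<^sup>1\<close> is \<open>\<theta> 0\<close> or \<open>\<theta> d\<close>, so
  that only one entry survives. It equals the sum of all \<open>l r\<close>, which is the trace of \<open>B\<close> minus
  the trace of \<open>C\<close>, hence \<open>\<beta> [d+1]\<close> by the known eigenvalues. Both facts about \<open>l\<close> are
  collected in \<open>A_bar_diagonal\<close>.

  It remains to evaluate the claimed polynomials in \<open>A\<close> at \<open>\<theta> r\<close>. The sum in the generic case
  is a telescoping Newton sum with value \<open>(x - \<theta> 0) / (x - \<theta> r)\<close> at \<open>x = q + q\<^sup>-\<^sup>1\<close>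
  (\<open>newton_sum_telescopes\<close>). For \<open>x = \<theta> 0\<close> the same sum is the indicator of \<open>r = 0\<close>, and the
  polynomial in the remaining case is a Lagrange polynomial, the indicator of \<open>r = d\<close>.
\<close>

section \<open>Coordinates with respect to a basis\<close>

text \<open>
  A basis together with its dual basis. Diagonal maps are then those that multiply each
  coordinate by a scalar, a form in which they compose and invert without matrix products.
\<close>

locale coordinate_system = vs scale
  for scale :: "'a::field \<Rightarrow> 'b::ab_group_add \<Rightarrow> 'b" (infixr "*s" 75) +
  fixes d :: nat and v :: "nat \<Rightarrow> 'b" and f :: "nat \<Rightarrow> 'b \<Rightarrow> 'a"
  assumes coord_add: "f i (x + y) = f i x + f i y"
    and coord_scale: "f i (r *s x) = r * f i x"
    and coord_basis: "i \<le> d \<Longrightarrow> j \<le> d \<Longrightarrow> f i (v j) = (if i = j then 1 else 0)"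
    and expansion: "x = (\<Sum>i\<le>d. f i x *s v i)"
begin

lemma coord_zero: "f i 0 = 0"
  using coord_scale[of i 0 0] by simp

lemma coord_diff: "f i (x - y) = f i x - f i y"
  using coord_add[of i "x - y" y] by simp

lemma coord_sum: "f i (sum g S) = (\<Sum>k\<in>S. f i (g k))"
  by (induction S rule: infinite_finite_induct) (auto simp: coord_zero coord_add)

lemma coord_eqI: "(\<And>i. i \<le> d \<Longrightarrow> f i x = f i y) \<Longrightarrow> x = y"
  using expansion[of x] expansion[of y] by (metis (no_types, lifting) atMost_iff sum.cong)

lemma coord_combination:
  "i \<le> d \<Longrightarrow> f i (\<Sum>j\<le>d. g j *s v j) = g i"
  by (simp add: coord_sum coord_scale coord_basis if_distrib cong: if_cong)

lemma represents_entry: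
  assumes "represents d v X M" "i \<le> d" "j \<le> d"
  shows "f i (X (v j)) = M i j"
  using assms by (simp add: represents_def coord_combination)

lemma linear_sum_scale:
  assumes "Vector_Spaces.linear scale scale X"
  shows "X (\<Sum>j\<in>S. g j *s u j) = (\<Sum>j\<in>S. g j *s X (u j))"
proof -
  interpret X: Vector_Spaces.linear scale scale X by fact
  show ?thesis by (simp add: X.sum X.scale)
qed

lemma coord_apply:
  assumes "Vector_Spaces.linear scale scale X"
  shows "f i (X x) = (\<Sum>j\<le>d. f i (X (v j)) * f j x)"
proof -
  have "X x = (\<Sum>j\<le>d. f j x *s X (v j))"
    using linear_sum_scale[OF assms, of "\<lambda>j. f j x" v "{..d}"] expansion[of x] by simp
  then show ?thesis
    by (simp add: coord_sum coord_scale mult.commute)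
qed

lemma eigenbasis_coord:
  assumes "Vector_Spaces.linear scale scale X"
    and "\<And>i. i \<le> d \<Longrightarrow> X (v i) = t i *s v i" and "i \<le> d"
  shows "f i (X x) = t i * f i x"
proof -
  have "f i (X x) = (\<Sum>j\<le>d. (if j = i then t i * f i x else 0))"
    unfolding coord_apply[OF assms(1), of i x]
    by (rule sum.cong) (use assms in \<open>auto simp: coord_scale coord_basis\<close>)
  then show ?thesis using assms(3) by simp
qed

text \<open>
  Distinctness of the eigenvalues makes each eigenspace the line through one basis vector. The
  coordinate projection therefore has the properties that characterize the primitive idempotent,
  and any other such map agrees with it on the basis.
\<close>

lemma primitive_idempotent_coord:
  assumes lin: "Vector_Spaces.linear scale scale X"
    and eig: "\<And>i. i \<le> d \<Longrightarrow> X (v i) = t i *s v i"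
    and inj: "inj_on t {..d}" and i: "i \<le> d"
  shows "primitive_idempotent X (t i) x = f i x *s v i"
proof -
  have fX: "f j (X y) = t j * f j y" if "j \<le> d" for j y
    using eigenbasis_coord[OF lin eig that] .
  have mem: "f j y = 0" if "y \<in> eigenspace X s" "j \<le> d" "t j \<noteq> s" for y s j
    using that fX[of j y] by (simp add: eigenspace_def coord_scale)
  have line: "y = f i y *s v i" if "y \<in> eigenspace X (t i)" for y
  proof (rule coord_eqI)
    fix j assume j: "j \<le> d"
    show "f j y = f j (f i y *s v i)"
    proof (cases "j = i")
      case False
      then have "t j \<noteq> t i" using inj i j by (auto dest: inj_onD)
      then show ?thesis using mem[OF that j] False i j by (simp add: coord_scale coord_basis)
    qed (use i in \<open>simp add: coord_scale coord_basis\<close>)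
  qed
  have vi: "r *s v i \<in> eigenspace X (t i)" for r
  proof -
    interpret X: Vector_Spaces.linear scale scale X by fact
    show ?thesis
      using i by (simp add: eigenspace_def X.scale eig scale_left_commute)
  qed
  have "primitive_idempotent X (t i) = (\<lambda>x. f i x *s v i)"
    unfolding primitive_idempotent_def
  proof (rule the_equality, intro conjI ballI allI impI)
    show "Vector_Spaces.linear scale scale (\<lambda>x. f i x *s v i)"
      by unfold_locales (auto simp: coord_add coord_scale algebra_simps)
    show "range (\<lambda>x. f i x *s v i) = eigenspace X (t i)"
      using vi line by blast
    show "f i y *s v i = y" if "y \<in> eigenspace X (t i)" for y
      using line[OF that] by simp
    show "f i y *s v i = 0" if "s \<noteq> t i" "y \<in> eigenspace X s" for s y
      using mem[OF that(2) i] that(1) by auto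
  next
    fix E
    assume E: "Vector_Spaces.linear scale scale E \<and> range E = eigenspace X (t i) \<and>
      (\<forall>y\<in>eigenspace X (t i). E y = y) \<and>
      (\<forall>s. s \<noteq> t i \<longrightarrow> (\<forall>y\<in>eigenspace X s. E y = 0))"
    have Ev: "E (v j) = (if j = i then v i else 0)" if "j \<le> d" for j
    proof (cases "j = i")
      case True
      then show ?thesis using E vi[of 1] by simp
    next
      case False
      then have "t j \<noteq> t i" using inj i that by (auto dest: inj_onD)
      moreover have "v j \<in> eigenspace X (t j)" using eig that by (simp add: eigenspace_def)
      ultimately show ?thesis using E False by auto
    qed
    show "E = (\<lambda>x. f i x *s v i)"
    proof
      fix x
      have "E x = E (\<Sum>j\<le>d. f j x *s v j)" using expansion[of x] by simp
      also have "\<dots> = (\<Sum>j\<le>d. f j x *s E (v j))" using E by (intro linear_sum_scale) blast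
      also have "\<dots> = (\<Sum>j\<le>d. if j = i then f i x *s v i else 0)"
        by (rule sum.cong) (auto simp: Ev)
      also have "\<dots> = f i x *s v i" using i by simp
      finally show "E x = f i x *s v i" .
    qed
  qed
  then show ?thesis by simp
qed

lemma coord_inverse_diagonal:
  assumes fW: "\<And>i x. i \<le> d \<Longrightarrow> f i (W x) = w i * f i x"
    and nz: "\<And>i. i \<le> d \<Longrightarrow> w i \<noteq> 0" and i: "i \<le> d"
  shows "f i (inv W x) = inverse (w i) * f i x"
proof -
  have "W (\<Sum>j\<le>d. (inverse (w j) * f j x) *s v j) = x"
    by (rule coord_eqI) (simp add: fW nz coord_combination)
  then have "W (inv W x) = x" by (metis f_inv_into_f rangeI)
  then have "f i x = w i * f i (inv W x)" using fW[OF i] by metis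
  then show ?thesis using nz[OF i] by simp
qed

lemma coord_shifted_product:
  assumes fX: "\<And>x. f i (X x) = s * f i x"
  shows "f i (shifted_product X t n x) = (\<Prod>j<n. s - t j) * f i x"
  by (induction n arbitrary: x)
    (simp_all add: coord_diff coord_scale fX algebra_simps)

end

context vs
begin

lemma ordered_basis_coordinates:
  assumes "ordered_basis d v"
  shows "\<exists>f. coordinate_system scale d v f"
proof -
  let ?S = "v ` {..d}"
  define f where "f i x = representation ?S x (v i)" for i x
  have inj: "inj_on v {..d}" and ind: "independent ?S" and sp: "span ?S = UNIV"
    using assms by (auto simp: ordered_basis_def)
  have "coordinate_system scale d v f"
  proof
    show "f i (x + y) = f i x + f i y" for i x y
      using ind sp by (simp add: f_def representation_add)
    show "f i (r *s x) = r * f i x" for i r x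
      using ind sp by (simp add: f_def representation_scale)
    show "f i (v j) = (if i = j then 1 else 0)" if "i \<le> d" "j \<le> d" for i j
      using ind that inj by (auto simp: f_def representation_basis dest: inj_onD)
    show "x = (\<Sum>i\<le>d. f i x *s v i)" for x
    proof -
      have "x = (\<Sum>u\<in>?S. representation ?S x u *s u)"
        using sum_representation_eq[OF ind, of x ?S] sp by simp
      then show ?thesis by (simp add: sum.reindex[OF inj] f_def)
    qed
  qed
  then show ?thesis by blast
qed

text \<open>
  Expanding \<open>X (v i)\<close> in the second basis and exchanging the two sums turns the trace in the first
  basis into the trace in the second one.
\<close>

lemma trace_basis_independent:
  assumes "coordinate_system scale d v f" and "coordinate_system scale d u g"
    and lin: "Vector_Spaces.linear scale scale X"
  shows "(\<Sum>i\<le>d. f i (X (v i))) = (\<Sum>j\<le>d. g j (X (u j)))"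
proof -
  interpret F: coordinate_system scale d v f by fact
  interpret G: coordinate_system scale d u g by fact
  have "(\<Sum>i\<le>d. f i (X (v i))) = (\<Sum>i\<le>d. f i (\<Sum>j\<le>d. g j (X (v i)) *s u j))"
    using G.expansion by metis
  also have "\<dots> = (\<Sum>i\<le>d. \<Sum>j\<le>d. g j (X (v i)) * f i (u j))"
    by (simp add: F.coord_sum F.coord_scale)
  also have "\<dots> = (\<Sum>j\<le>d. \<Sum>i\<le>d. g j (X (v i)) * f i (u j))"
    by (rule sum.swap)
  also have "\<dots> = (\<Sum>j\<le>d. g j (\<Sum>i\<le>d. f i (u j) *s X (v i)))"
    by (simp add: G.coord_sum G.coord_scale mult.commute)
  also have "\<dots> = (\<Sum>j\<le>d. g j (X (\<Sum>i\<le>d. f i (u j) *s v i)))"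
    by (simp add: F.linear_sum_scale[OF lin])
  also have "\<dots> = (\<Sum>j\<le>d. g j (X (u j)))"
    using F.expansion by metis
  finally show ?thesis .
qed

lemma trace_eq_sum_standard_ordering:
  assumes "coordinate_system scale d v f" and "Vector_Spaces.linear scale scale X"
    and "standard_ordering d X Y Z t"
  shows "(\<Sum>i\<le>d. f i (X (v i))) = (\<Sum>i\<le>d. t i)"
proof -
  obtain u where u: "\<forall>i\<le>d. u i \<in> eigenspace X (t i)" and "ordered_basis d u"
    using assms(3) by (auto simp: standard_ordering_def leonard_basis_def)
  then obtain g where g: "coordinate_system scale d u g"
    using ordered_basis_coordinates by blast
  then interpret G: coordinate_system scale d u g .
  have "(\<Sum>j\<le>d. g j (X (u j))) = (\<Sum>j\<le>d. t j)"
    by (rule sum.cong) (use u in \<open>auto simp: eigenspace_def G.coord_scale G.coord_basis\<close>)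
  then show ?thesis using trace_basis_independent[OF assms(1) g assms(2)] by simp
qed

end

section \<open>Scalar identities\<close>

lemma sum_powi_q_bracket:
  fixes q :: "'f::field"
  assumes "q \<noteq> 0" "q ^ 2 \<noteq> 1"
  shows "(\<Sum>i\<le>d. q powi (2 * int i - int d)) = q_bracket q (int d + 1)"
    and "(\<Sum>i\<le>d. q powi (int d - 2 * int i)) = q_bracket q (int d + 1)"
proof -
  have nz: "q - inverse q \<noteq> 0" using assms by (auto simp: field_simps power2_eq_square)
  let ?g = "\<lambda>i. q powi (2 * int i - int d - 1)"
  have step: "(q - inverse q) * q powi m = q powi (m + 1) - q powi (m - 1)" for m
    using assms(1) by (simp add: power_int_add power_int_diff field_simps)
  have "(q - inverse q) * (\<Sum>i\<le>d. q powi (2 * int i - int d)) = (\<Sum>i<Suc d. ?g (Suc i) - ?g i)"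
    unfolding sum_distrib_left lessThan_Suc_atMost
    by (rule sum.cong, simp) (simp only: step, simp add: algebra_simps)
  also have "\<dots> = q powi (int d + 1) - q powi (- (int d + 1))"
    unfolding sum_lessThan_telescope[of ?g "Suc d"]
    by (intro arg_cong2[of _ _ _ _ minus] arg_cong[of _ _ "\<lambda>m. q powi m"]) simp_all
  finally show *: "(\<Sum>i\<le>d. q powi (2 * int i - int d)) = q_bracket q (int d + 1)"
    using nz by (simp add: q_bracket_def field_simps)
  have "(\<Sum>i\<le>d. q powi (int d - 2 * int i)) = (\<Sum>i\<le>d. q powi (2 * int i - int d))"
    by (rule sum.reindex_bij_witness[of _ "\<lambda>i. d - i" "\<lambda>i. d - i"])
      (auto simp: of_nat_diff algebra_simps)
  with * show "(\<Sum>i\<le>d. q powi (int d - 2 * int i)) = q_bracket q (int d + 1)" by simp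
qed

lemma sum_qr_theta:
  fixes q :: "'f::field"
  assumes "q \<noteq> 0" "q ^ 2 \<noteq> 1"
  shows "(\<Sum>i\<le>d. qr_theta q d x i) = (x + inverse x) * q_bracket q (int d + 1)"
  unfolding qr_theta_def sum.distrib sum_distrib_left[symmetric] sum_powi_q_bracket[OF assms]
  by (simp add: algebra_simps)

text \<open>
  Writing \<open>x - t r\<close> as \<open>(x - t i) - (t r - t i)\<close> in front of the \<open>i\<close>-th summand makes the sum
  telescope; the last term vanishes because it contains the factor \<open>t r - t r\<close>.
\<close>

lemma newton_sum_telescopes:
  fixes t :: "nat \<Rightarrow> 'f::field"
  assumes "\<And>j. 1 \<le> j \<Longrightarrow> j \<le> d \<Longrightarrow> x \<noteq> t j" and "r \<le> d"
  shows "(x - t r) * (\<Sum>i\<le>d. inverse (\<Prod>j=1..i. x - t j) * (\<Prod>j<i. t r - t j)) = x - t 0"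
proof -
  let ?T = "\<lambda>i. inverse (\<Prod>j=1..i. x - t j) * (\<Prod>j<i. t r - t j)"
  \<comment> \<open>The product of the last summand with \<open>t r - t n\<close> is the part not yet cancelled.\<close>
  have partial: "(x - t r) * (\<Sum>i\<le>n. ?T i) = (x - t 0) - (t r - t n) * ?T n" if "n \<le> d" for n
    using that
  proof (induction n)
    case (Suc n)
    have nz: "x - t (Suc n) \<noteq> 0" using assms(1)[of "Suc n"] Suc.prems by simp
    have T: "(x - t (Suc n)) * ?T (Suc n) = (t r - t n) * ?T n"
      using nz by simp
    have "(x - t r) * (\<Sum>i\<le>Suc n. ?T i)
        = (x - t 0) - (t r - t n) * ?T n + (x - t r) * ?T (Suc n)"
      using Suc by (simp add: distrib_left)
    also have "\<dots> = (x - t 0) - (t r - t (Suc n)) * ?T (Suc n)"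
      unfolding T[symmetric] by (simp add: left_diff_distrib)
    finally show ?case .
  qed simp
  show ?thesis
  proof (cases "r = d")
    case False
    then have "(\<Prod>j<d. t r - t j) = 0" using assms(2) by (intro prod_zero) auto
    then show ?thesis using partial[of d] by simp
  qed (use partial[of d] in simp)
qed

text \<open>
  At \<open>x = t 0\<close> the telescoped value \<open>x - t 0\<close> is zero, which forces the sum to vanish unless
  \<open>r = 0\<close>; there the factor \<open>x - t r\<close> is zero too, but the sum has only its first term.
\<close>

lemma newton_sum_at_node:
  fixes t :: "nat \<Rightarrow> 'f::field"
  assumes inj: "inj_on t {..d}" and r: "r \<le> d"
  shows "(\<Sum>i\<le>d. inverse (\<Prod>j=1..i. t 0 - t j) * (\<Prod>j<i. t r - t j)) = (if r = 0 then 1 else 0)"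
proof (cases "r = 0")
  case True
  have "(\<Sum>i\<le>d. inverse (\<Prod>j=1..i. t 0 - t j) * (\<Prod>j<i. t r - t j))
      = (\<Sum>i\<le>d. if i = 0 then 1 else 0)"
  proof (rule sum.cong)
    show "inverse (\<Prod>j=1..i. t 0 - t j) * (\<Prod>j<i. t r - t j) = (if i = 0 then 1 else 0)" for i
      using True by (cases i) (simp_all add: prod_zero_iff lessThan_Suc_eq_insert_0)
  qed simp
  then show ?thesis using True by simp
next
  case False
  have ne: "t 0 \<noteq> t j" if "1 \<le> j" "j \<le> d" for j
    using inj that by (auto dest: inj_onD)
  show ?thesis
    using newton_sum_telescopes[of d "t 0" t r, OF ne r] ne[of r] False r by simp
qed

lemma lagrange_at_node:
  fixes t :: "nat \<Rightarrow> 'f::field"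
  assumes inj: "inj_on t {..d}" and r: "r \<le> d"
  shows "inverse (\<Prod>j<d. t d - t j) * (\<Prod>j<d. t r - t j) = (if r = d then 1 else 0)"
proof (cases "r = d")
  case True
  have "t d - t j \<noteq> 0" if "j < d" for j using inj that by (auto dest: inj_onD)
  then have "(\<Prod>j<d. t d - t j) \<noteq> 0" by (simp add: prod_zero_iff)
  then show ?thesis using True by simp
next
  case False
  then have "(\<Prod>j<d. t r - t j) = 0" using r by (intro prod_zero) auto
  then show ?thesis using False by simp
qed

text \<open>The eigenvalues of \<open>W\<close>.\<close>

definition W_weight :: "'f::field \<Rightarrow> 'f \<Rightarrow> nat \<Rightarrow> nat \<Rightarrow> 'f" where
  "W_weight q a d i = (- 1) ^ i * inverse a ^ i * q ^ (i * (d - i))"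

text \<open>
  The factor between consecutive eigenvalues of \<open>W\<close> is, up to sign, the scalar \<open>z\<close> that the next
  lemma finds in the off-diagonal part of \<open>q A B - q\<^sup>-\<^sup>1 B A\<close>.
\<close>

lemma W_weight_Suc:
  fixes q :: "'f::field"
  assumes "q \<noteq> 0" "a \<noteq> 0" "j < d"
  shows "W_weight q a d j = - (a * q powi (2 * int j - int d) * q) * W_weight q a d (Suc j)"
proof -
  have e: "int (j * (d - j)) = (2 * int j - int d) + 1 + int (Suc j * (d - Suc j))"
    using less_imp_Suc_add[OF assms(3)] by (auto simp: algebra_simps)
  have "q ^ (j * (d - j)) = q powi (int (j * (d - j)))" by (simp only: power_int_of_nat)
  also have "\<dots> = q powi (2 * int j - int d) * q * q ^ (Suc j * (d - Suc j))"
    unfolding e using assms(1) by (simp only: power_int_add power_int_of_nat power_int_1_right simp_thms disj_not1)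
  finally show ?thesis using assms(2) by (simp add: W_weight_def field_simps)
qed

text \<open>
  In an eigenbasis of \<open>A\<close> the entry \<open>(i, j)\<close> of \<open>q A B - q\<^sup>-\<^sup>1 B A\<close> is
  \<open>q \<theta> i - q\<^sup>-\<^sup>1 \<theta> j\<close> times that of \<open>B\<close>. For adjacent indices one of the two exponentials in
  \<open>\<theta>\<close> cancels, which leaves a monomial times the normalizing factor of the relations.
\<close>

lemma qr_theta_skew_Suc:
  fixes q a :: "'f::field" and d j :: nat
  assumes "q \<noteq> 0" "a \<noteq> 0"
  defines "z \<equiv> a * q powi (2 * int j - int d) * q"
  shows "q * qr_theta q d a (Suc j) - inverse q * qr_theta q d a j = z * (q ^ 2 - inverse q ^ 2)"
    and "q * qr_theta q d a j - inverse q * qr_theta q d a (Suc j)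
      = inverse z * (q ^ 2 - inverse q ^ 2)"
proof -
  define u where "u = q powi (2 * int j - int d)"
  have u: "u \<noteq> 0" using assms(1) by (simp add: u_def)
  have ui: "q powi (int d - 2 * int j) = inverse u"
    unfolding u_def power_int_minus[symmetric] by simp
  have us: "q powi (2 * int (Suc j) - int d) = u * q ^ 2"
  proof -
    have "2 * int (Suc j) - int d = (2 * int j - int d) + 2" by simp
    then show ?thesis using assms(1) unfolding u_def by (simp only: power_int_add simp_thms) simp
  qed
  have usi: "q powi (int d - 2 * int (Suc j)) = inverse (u * q ^ 2)"
    unfolding us[symmetric] power_int_minus[symmetric] by simp
  have th: "qr_theta q d a j = a * u + inverse a * inverse u"
    "qr_theta q d a (Suc j) = a * (u * q ^ 2) + inverse a * inverse (u * q ^ 2)"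
    unfolding qr_theta_def us usi ui by (simp_all add: u_def)
  show "q * qr_theta q d a (Suc j) - inverse q * qr_theta q d a j = z * (q ^ 2 - inverse q ^ 2)"
    "q * qr_theta q d a j - inverse q * qr_theta q d a (Suc j)
      = inverse z * (q ^ 2 - inverse q ^ 2)"
    unfolding th z_def u_def[symmetric] using u assms(1,2)
    by (simp_all add: field_simps power2_eq_square)
qed

section \<open>The map is diagonal in an eigenbasis\<close>

context vs
begin

lemma Z3_relation_coord:
  assumes "coordinate_system scale d v f" "Z3_relation q X Y Z s" "i \<le> d" "j \<le> d"
  shows "f i (X (v j)) + (q * f i (Y (Z (v j))) - inverse q * f i (Z (Y (v j))))
      / (q ^ 2 - inverse q ^ 2) = (if i = j then s else 0)"
proof -
  interpret coordinate_system scale d v f by fact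
  have "f i (X (v j) + inverse (q ^ 2 - inverse q ^ 2) *s
      (q *s Y (Z (v j)) - inverse q *s Z (Y (v j)))) = f i (s *s v j)"
    using assms(2) by (simp add: Z3_relation_def)
  then show ?thesis
    using assms(3,4) by (simp add: coord_add coord_diff coord_scale coord_basis divide_inverse mult.commute)
qed

text \<open>
  The heart of the proof: \<open>W\<^sup>-\<^sup>1 B W - C\<close> acts diagonally on an eigenbasis of \<open>A\<close>. Its diagonal
  entries satisfy a linear equation each, and their sum is the difference of two traces. The sum is
  what determines the one entry whose equation degenerates when \<open>q + q\<^sup>-\<^sup>1\<close> is an eigenvalue of \<open>A\<close>.
\<close>

lemma A_bar_diagonal:
  assumes par: "huang_params q a b c d" and trip: "q_Racah_triple q a b c d A B C"
  defines "\<theta> \<equiv> qr_theta q d a"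
  defines "\<beta> \<equiv> (b - c) * (b - inverse c) * inverse b"
  shows "\<exists>v f l. coordinate_system scale d v f \<and> inj_on \<theta> {..d} \<and>
    (\<forall>r\<le>d. \<forall>x. f r (A x) = \<theta> r * f r x) \<and>
    (\<forall>r\<le>d. \<forall>x. f r (A_bar q a d A B C x) = l r * f r x) \<and>
    (\<forall>r\<le>d. (q + inverse q - \<theta> r) * l r
       = \<beta> * (q powi (int d + 1) + q powi (- int d - 1) - a - inverse a)) \<and>
    (\<Sum>r\<le>d. l r) = \<beta> * q_bracket q (int d + 1)"
proof -
  have q0: "q \<noteq> 0" and a0: "a \<noteq> 0" and b0: "b \<noteq> 0" and c0: "c \<noteq> 0" and q4: "q ^ 4 \<noteq> 1"
    using par by (auto simp: huang_params_def)
  have q44: "q ^ 4 - 1 = (q ^ 2 - 1) * (q ^ 2 + 1)"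
    by (simp add: algebra_simps flip: power_add)
  have q2: "q ^ 2 \<noteq> 1" and q2': "q ^ 2 + 1 \<noteq> 0" using q4 q44 by auto
  have m0: "q - inverse q \<noteq> 0" and p0: "q + inverse q \<noteq> 0"
    using q2 q2' q0 by (auto simp: field_simps power2_eq_square)
  have pm: "q ^ 2 - inverse q ^ 2 = (q - inverse q) * (q + inverse q)"
    by (simp add: algebra_simps power2_eq_square)
  then have D0: "q ^ 2 - inverse q ^ 2 \<noteq> 0" using m0 p0 by simp
  have linA: "Vector_Spaces.linear scale scale A" and linB: "Vector_Spaces.linear scale scale B"
    and linC: "Vector_Spaces.linear scale scale C"
    and soA: "standard_ordering d A B C \<theta>" and soB: "standard_ordering d B C A (qr_theta q d b)"
    and soC: "standard_ordering d C A B (qr_theta q d c)"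
    and Zb: "Z3_relation q B C A (qr_alpha q d b c a)"
    and Zc: "Z3_relation q C A B (qr_alpha q d c a b)"
    using trip by (auto simp: q_Racah_triple_def leonard_triple_def \<theta>_def)
  have inj: "inj_on \<theta> {..d}" using soA by (auto simp: standard_ordering_def bij_betw_def)
  obtain v M where ve: "\<forall>i\<le>d. v i \<in> eigenspace A (\<theta> i)" and ob: "ordered_basis d v"
    and M: "represents d v B M" "tridiagonal_matrix d M"
    using soA by (auto simp: standard_ordering_def leonard_basis_def irreducible_tridiagonal_matrix_def)
  obtain f where cs: "coordinate_system scale d v f"
    using ordered_basis_coordinates[OF ob] by blast
  interpret coordinate_system scale d v f by (fact cs)
  have Av: "A (v i) = \<theta> i *s v i" if "i \<le> d" for i
    using ve that by (simp add: eigenspace_def)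
  have fA: "f i (A x) = \<theta> i * f i x" if "i \<le> d" for i x
    using eigenbasis_coord[OF linA Av that] .
  have scaleB: "B (r *s x) = r *s B x" and scaleC: "C (r *s x) = r *s C x" for r x
    using linB linC by (simp_all add: Vector_Spaces.linear_iff)
  have off: "f i (B (v j)) = 0" if "i \<le> d" "j \<le> d" "i \<noteq> j" "i \<noteq> Suc j" "j \<noteq> Suc i" for i j
    using M that unfolding represents_entry[OF M(1) that(1,2)] tridiagonal_matrix_def by metis
  have relC: "f i (C (v j)) + (q * \<theta> i - inverse q * \<theta> j) * f i (B (v j)) / (q ^ 2 - inverse q ^ 2)
      = (if i = j then qr_alpha q d c a b else 0)" if "i \<le> d" "j \<le> d" for i j
    using Z3_relation_coord[OF cs Zc that]
    by (simp add: fA Av scaleB coord_scale that algebra_simps)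
  have relB: "f i (B (v i)) + (q - inverse q) * \<theta> i * f i (C (v i)) / (q ^ 2 - inverse q ^ 2)
      = qr_alpha q d b c a" if "i \<le> d" for i
    using Z3_relation_coord[OF cs Zb that that]
    by (simp add: fA Av scaleC coord_scale that algebra_simps)
  let ?w = "W_weight q a d"
  have w0: "?w i \<noteq> 0" for i using q0 a0 by (simp add: W_weight_def)
  have fW: "f i (W_map q a d A x) = ?w i * f i x" if "i \<le> d" for i x
    using coord_combination[OF that, of "\<lambda>j. ?w j * f j x"]
    by (simp add: W_map_def W_weight_def primitive_idempotent_coord[OF linA Av inj] flip: \<theta>_def)
  \<comment> \<open>Conjugation by \<open>W\<close> turns the off-diagonal entries of \<open>B\<close> into those of \<open>C\<close>.\<close>
  have conj: "?w j * f i (B (v j)) = ?w i * f i (C (v j))"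
    if "i \<le> d" "j \<le> d" "i \<noteq> j" for i j
  proof -
    have C: "f i (C (v j)) = - ((q * \<theta> i - inverse q * \<theta> j) / (q ^ 2 - inverse q ^ 2)) * f i (B (v j))"
      using relC[OF that(1,2)] that(3) by (simp add: eq_neg_iff_add_eq_0)
    consider "i = Suc j" | "j = Suc i" | "i \<noteq> Suc j" "j \<noteq> Suc i" by blast
    then show ?thesis
    proof cases
      case 1
      then show ?thesis
        using C D0 W_weight_Suc[OF q0 a0, of j d] that
        unfolding \<theta>_def by (simp add: qr_theta_skew_Suc[OF q0 a0])
    next
      case 2
      define z where "z = a * q powi (2 * int i - int d) * q"
      have z: "z \<noteq> 0" using q0 a0 by (simp add: z_def)
      have "?w i = - z * ?w j"
        using W_weight_Suc[OF q0 a0, of i d] 2 that by (simp add: z_def)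
      moreover have "f i (C (v j)) = - inverse z * f i (B (v j))"
        using C D0 unfolding 2 \<theta>_def qr_theta_skew_Suc(2)[OF q0 a0, where j = i and d = d, folded z_def] by simp
      ultimately show ?thesis using z by simp
    next
      case 3
      then show ?thesis using C off that by simp
    qed
  qed
  define l where "l r = f r (B (v r)) - f r (C (v r))" for r
  have bar: "f r (A_bar q a d A B C x) = l r * f r x" if r: "r \<le> d" for r x
  proof -
    have inv: "f r (inv (W_map q a d A) y) = inverse (?w r) * f r y" for y
      using coord_inverse_diagonal[of "W_map q a d A" ?w] fW w0 r by blast
    have "f r (A_bar q a d A B C x)
        = inverse (?w r) * (\<Sum>j\<le>d. f r (B (v j)) * (?w j * f j x)) - (\<Sum>j\<le>d. f r (C (v j)) * f j x)"
      unfolding A_bar_def coord_diff inv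
        coord_apply[OF linB, of r "W_map q a d A x"] coord_apply[OF linC, of r x]
      by (simp add: fW)
    also have "\<dots> = (\<Sum>j\<le>d. (inverse (?w r) * (?w j * f r (B (v j))) - f r (C (v j))) * f j x)"
      by (simp add: sum_distrib_left algebra_simps flip: sum_subtractf)
    also have "\<dots> = (\<Sum>j\<le>d. if j = r then l r * f r x else 0)"
      by (rule sum.cong) (use conj[OF r] w0 in \<open>auto simp: l_def\<close>)
    finally show ?thesis using r by simp
  qed
  have \<beta>: "\<beta> = (b + inverse b) - (c + inverse c)"
    using b0 c0 by (simp add: \<beta>_def field_simps)
  \<comment> \<open>The diagonal parts of the relations for \<open>B\<close> and \<open>C\<close> form a linear system in the two
    diagonal entries whose coefficients are symmetric in them, so its difference isolates \<open>l r\<close>.\<close>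
  have rel: "(q + inverse q - \<theta> r) * l r
      = \<beta> * (q powi (int d + 1) + q powi (- int d - 1) - a - inverse a)" if r: "r \<le> d" for r
  proof -
    let ?k = "q + inverse q"
    have "f r (B (v r)) + \<theta> r * f r (C (v r)) / ?k = qr_alpha q d b c a"
      "f r (C (v r)) + \<theta> r * f r (B (v r)) / ?k = qr_alpha q d c a b"
      using relB[OF r] relC[OF r r] m0 unfolding pm left_diff_distrib[symmetric]
      by (simp_all add: mult.assoc)
    then have "?k * f r (B (v r)) + \<theta> r * f r (C (v r)) = ?k * qr_alpha q d b c a"
      "?k * f r (C (v r)) + \<theta> r * f r (B (v r)) = ?k * qr_alpha q d c a b"
      using p0 by (metis distrib_left nonzero_mult_div_cancel_left times_divide_eq_right)+
    then have "(?k - \<theta> r) * l r = ?k * qr_alpha q d b c a - ?k * qr_alpha q d c a b"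
      unfolding l_def by (simp add: algebra_simps)
    also have "\<dots> = \<beta> * (q powi (int d + 1) + q powi (- int d - 1) - a - inverse a)"
      unfolding \<beta> qr_alpha_def times_divide_eq_right nonzero_mult_div_cancel_left[OF p0]
      by (simp add: algebra_simps)
    finally show ?thesis .
  qed
  have tr: "(\<Sum>r\<le>d. l r) = \<beta> * q_bracket q (int d + 1)"
    unfolding l_def sum_subtractf trace_eq_sum_standard_ordering[OF cs linB soB]
      trace_eq_sum_standard_ordering[OF cs linC soC] sum_qr_theta[OF q0 q2] \<beta>
    by (simp add: algebra_simps)
  show ?thesis using cs inj fA bar rel tr by blast
qed

end

section \<open>The three formulas\<close>

theorem proposition8p12:
  fixes scale :: "'f::field \<Rightarrow> 'v::ab_group_add \<Rightarrow> 'v" (infixr "*s" 75)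
    and q a b c :: 'f and d :: nat and A B C :: "'v \<Rightarrow> 'v" and \<theta> :: "nat \<Rightarrow> 'f"
  assumes "vector_space scale"
    and "vector_space.dim scale (UNIV :: 'v set) = d + 1"
    and "huang_params q a b c d"
    and "vs.q_Racah_triple scale q a b c d A B C"
    and "\<theta> = qr_theta q d a"
  shows
    "(a = q ^ (d + 1) \<longrightarrow>
        vs.A_bar scale q a d A B C =
          (\<lambda>v. ((b - c) * (b - inverse c) * inverse b * q_bracket q (int d + 1)) *s
            (\<Sum>i\<le>d. inverse (\<Prod>j=1..i. \<theta> 0 - \<theta> j) *s
              vs.shifted_product scale A \<theta> i v))) \<and>
     (a = q powi (- int d - 1) \<longrightarrow>
        vs.A_bar scale q a d A B C =
          (\<lambda>v. ((b - c) * (b - inverse c) * inverse b * q_bracket q (int d + 1)) *s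
            (inverse (\<Prod>j<d. \<theta> d - \<theta> j) *s
              vs.shifted_product scale A \<theta> d v))) \<and>
     (a \<noteq> q ^ (d + 1) \<and> a \<noteq> q powi (- int d - 1) \<longrightarrow>
        vs.A_bar scale q a d A B C =
          (\<lambda>v. ((a - q powi (- int d - 1)) * (b - c) * (b - inverse c) * inverse b * q ^ d
                / (a - q powi (int d - 1))) *s
            (\<Sum>i\<le>d. inverse (\<Prod>j=1..i. q + inverse q - \<theta> j) *s
              vs.shifted_product scale A \<theta> i v)))"
proof -
  interpret vs scale using assms(1) by (simp add: vs_def)
  define \<beta> where "\<beta> = (b - c) * (b - inverse c) * inverse b"
  define P where "P = q powi (int d + 1)"
  have q0: "q \<noteq> 0" and a0: "a \<noteq> 0"
    and aq: "\<And>k::int. - int d < k \<Longrightarrow> k < int d \<Longrightarrow> a ^ 2 \<noteq> q powi (2 * k)"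
    using assms(3) by (auto simp: huang_params_def)
  have P0: "P \<noteq> 0" and Pn: "q ^ (d + 1) = P" and Pi: "q powi (- int d - 1) = inverse P"
  proof -
    show "P \<noteq> 0" "q ^ (d + 1) = P" using q0 by (simp_all add: P_def power_int_add)
    have "- int d - 1 = - (int d + 1)" by simp
    then show "q powi (- int d - 1) = inverse P" unfolding P_def by (simp only: power_int_minus)
  qed
  obtain v f l where cs: "coordinate_system scale d v f" and inj: "inj_on \<theta> {..d}"
    and fA: "\<And>r x. r \<le> d \<Longrightarrow> f r (A x) = \<theta> r * f r x"
    and bar: "\<And>r x. r \<le> d \<Longrightarrow> f r (A_bar q a d A B C x) = l r * f r x"
    and rel: "\<And>r. r \<le> d \<Longrightarrow> (q + inverse q - \<theta> r) * l r = \<beta> * (P + inverse P - a - inverse a)"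
    and tr: "(\<Sum>r\<le>d. l r) = \<beta> * q_bracket q (int d + 1)"
    using A_bar_diagonal[OF assms(3,4)] unfolding assms(5) \<beta>_def P_def Pi[unfolded P_def] by blast
  interpret coordinate_system scale d v f by (fact cs)
  have fT: "f r (shifted_product A \<theta> n x) = (\<Prod>j<n. \<theta> r - \<theta> j) * f r x" if "r \<le> d" for r n x
    by (rule coord_shifted_product) (rule fA[OF that])
  have fN: "f r (\<Sum>i\<le>d. g i *s shifted_product A \<theta> i x)
      = (\<Sum>i\<le>d. g i * (\<Prod>j<i. \<theta> r - \<theta> j)) * f r x" if "r \<le> d" for r g x
    by (simp add: coord_sum coord_scale fT[OF that] sum_distrib_right mult.assoc)
  \<comment> \<open>In the exceptional cases all entries but one vanish, and the trace gives the last one.\<close>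
  have single: "l r = (if r = s then \<beta> * q_bracket q (int d + 1) else 0)"
    if s: "s \<le> d" "\<theta> s = q + inverse q" and van: "P + inverse P - a - inverse a = 0"
      and r: "r \<le> d" for r s
  proof -
    have z: "l j = 0" if "j \<le> d" "j \<noteq> s" for j
      using rel[OF that(1)] van inj that s by (auto dest: inj_onD)
    have "(\<Sum>j\<le>d. l j) = (\<Sum>j\<le>d. if j = s then l s else 0)"
      by (rule sum.cong) (auto simp: z)
    then have "l s = \<beta> * q_bracket q (int d + 1)" using s tr by simp
    then show ?thesis using z r by simp
  qed
  have th0: "\<theta> 0 = a * (q * inverse P) + inverse a * (P * inverse q)"
    using q0 by (simp add: assms(5) qr_theta_def P_def power_int_add power_int_minus field_simps)
  have thd: "\<theta> d = a * (P * inverse q) + inverse a * (q * inverse P)"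
    using q0 by (simp add: assms(5) qr_theta_def P_def power_int_add power_int_minus field_simps)
  have i: "A_bar q a d A B C x = (\<beta> * q_bracket q (int d + 1)) *s
      (\<Sum>i\<le>d. inverse (\<Prod>j=1..i. \<theta> 0 - \<theta> j) *s shifted_product A \<theta> i x)" if "a = P" for x
  proof (rule coord_eqI)
    fix r assume r: "r \<le> d"
    have "\<theta> 0 = q + inverse q" using th0 that P0 q0 by (simp add: field_simps)
    with that have lr: "l r = (if r = 0 then \<beta> * q_bracket q (int d + 1) else 0)"
      using r by (intro single) auto
    show "f r (A_bar q a d A B C x) = f r ((\<beta> * q_bracket q (int d + 1)) *s
        (\<Sum>i\<le>d. inverse (\<Prod>j=1..i. \<theta> 0 - \<theta> j) *s shifted_product A \<theta> i x))"
      by (simp only: bar[OF r] lr coord_scale fN[OF r] newton_sum_at_node[OF inj r]) simp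
  qed
  have ii: "A_bar q a d A B C x = (\<beta> * q_bracket q (int d + 1)) *s
      (inverse (\<Prod>j<d. \<theta> d - \<theta> j) *s shifted_product A \<theta> d x)" if "a = inverse P" for x
  proof (rule coord_eqI)
    fix r assume r: "r \<le> d"
    have "\<theta> d = q + inverse q" using thd that P0 q0 by (simp add: field_simps)
    with that have lr: "l r = (if r = d then \<beta> * q_bracket q (int d + 1) else 0)"
      using r by (intro single) auto
    show "f r (A_bar q a d A B C x) = f r ((\<beta> * q_bracket q (int d + 1)) *s
        (inverse (\<Prod>j<d. \<theta> d - \<theta> j) *s shifted_product A \<theta> d x))"
      by (simp only: bar[OF r] lr coord_scale fT[OF r] mult.assoc[symmetric])
        (simp add: lagrange_at_node[OF inj r] mult.assoc)
  qed
  have iii: "A_bar q a d A B C x = ((a - inverse P) * \<beta> * q ^ d / (a - q powi (int d - 1))) *s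
      (\<Sum>i\<le>d. inverse (\<Prod>j=1..i. q + inverse q - \<theta> j) *s shifted_product A \<theta> i x)"
    if nP: "a \<noteq> P" "a \<noteq> inverse P" for x
  proof -
    let ?k = "q + inverse q"
    have van: "P + inverse P - a - inverse a = (P - a) * (a - inverse P) / a"
      using a0 P0 by (simp add: field_simps)
    have ne: "?k \<noteq> \<theta> r" if r: "r \<le> d" for r
    proof
      assume eq: "?k = \<theta> r"
      let ?e = "q powi (int d - 2 * int r)"
      have e0: "?e \<noteq> 0" using q0 by simp
      have "\<theta> r = a * inverse ?e + inverse a * ?e"
        by (simp add: assms(5) qr_theta_def flip: power_int_minus)
      with eq have "(a - ?e * q) * (a - ?e * inverse q) = 0"
        using a0 q0 e0 by (simp add: field_simps)
      then have "a = ?e * q \<or> a = ?e * inverse q" by simp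
      then have "a = q powi (int d - 2 * int r + 1) \<or> a = q powi (int d - 2 * int r - 1)"
        using q0 by (simp add: power_int_add power_int_diff divide_inverse)
      then obtain m where m: "a = q powi m"
        and m_cases: "m = int d - 2 * int r + 1 \<or> m = int d - 2 * int r - 1" by blast
      \<comment> \<open>The hypothesis on \<open>a\<^sup>2\<close> excludes \<open>\<bar>m\<bar> < d\<close>; only the extreme exponents, which
        belong to the exceptional cases, are left.\<close>
      have "a ^ 2 = q powi (2 * m)"
        unfolding m by (simp add: power_int_mult mult.commute[of 2])
      then have "m \<le> - int d \<or> m \<ge> int d" using aq[of m] by force
      then have "m = int d + 1 \<or> m = - int d - 1" using m_cases r by presburger
      then show False using m nP Pi by (auto simp: P_def)
    qed
    \<comment> \<open>The denominator \<open>a - Q\<close> is a factor of \<open>q + q\<^sup>-\<^sup>1 - \<theta> 0\<close>, hence nonzero.\<close>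
    define Q where "Q = q powi (int d - 1)"
    have PQ: "P = Q * q ^ 2" and qd: "q ^ d = Q * q"
      using q0 by (simp_all add: P_def Q_def power_int_add power_int_diff power2_eq_square)
    have Q0: "Q \<noteq> 0" using q0 by (simp add: Q_def)
    have k0: "?k - \<theta> 0 = (P - a) * (a - Q) / (a * q ^ d)"
      unfolding th0 qd PQ using a0 q0 Q0 by (simp add: field_simps power2_eq_square)
    with ne[of 0] have aQ: "a - Q \<noteq> 0" by auto
    show ?thesis
    proof (rule coord_eqI)
      fix r assume r: "r \<le> d"
      let ?S = "\<Sum>i\<le>d. inverse (\<Prod>j=1..i. ?k - \<theta> j) * (\<Prod>j<i. \<theta> r - \<theta> j)"
      let ?K = "(a - inverse P) * \<beta> * q ^ d / (a - Q)"
      have kr: "?k - \<theta> r \<noteq> 0" using ne[OF r] by simp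
      have S: "(?k - \<theta> r) * ?S = ?k - \<theta> 0"
        by (rule newton_sum_telescopes) (use ne r in auto)
      have "(?k - \<theta> r) * (?K * ?S) = ?K * (?k - \<theta> 0)"
        unfolding S[symmetric] by (simp only: mult_ac)
      also have "\<dots> = \<beta> * ((P - a) * (a - inverse P) / a)"
        unfolding k0 using aQ a0 q0 by simp
      also have "\<dots> = (?k - \<theta> r) * l r" by (simp only: rel[OF r] van)
      finally have "?K * ?S = l r" by (rule mult_left_cancel[OF kr, THEN iffD1])
      then show "f r (A_bar q a d A B C x) = f r (((a - inverse P) * \<beta> * q ^ d /
          (a - q powi (int d - 1))) *s
          (\<Sum>i\<le>d. inverse (\<Prod>j=1..i. ?k - \<theta> j) *s shifted_product A \<theta> i x))"
        unfolding bar[OF r] coord_scale fN[OF r] Q_def[symmetric] by (simp only: mult.assoc[symmetric])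
    qed
  qed
  show ?thesis
    using i ii iii unfolding Pn Pi \<beta>_def by (auto simp: mult.assoc)
qed

end
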